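(* Let $P=(V_1,\dots,V_n)$ be a spherical polygon on the unit sphere $S^2\subset\mathbb{R}^3$. For a point $W\in S^2$ distinct from the vertices of $P$, let $O_i\in S^2$ be the circumcenter of the oriented spherical triangle $WV_iV_{i+1}$ (indices cyclic mod $n$), taken with the mass $m_i$ equal to the area of the plane (Euclidean) triangle $WV_iV_{i+1}$, and let $CCM(P)$ be the spherical center of mass $$ CCM(P)=\frac{\sum_i m_iO_i}{\left|\sum_i m_iO_i\right|} $$ of the collection $(O_i,m_i)$ (assumed to be defined, i.e. $\sum_i m_iO_i\ne0$). Then the point $CCM(P)$ does not depend on the choice of $W$.
   Context: $P=(V_1,\dots,V_n)$ is given by a cyclic sequence of points of $S^2$ with consecutive vertices distinct. For three distinct points $A,B,C\in S^2$, the circumcircle of the oriented spherical triangle $ABC$ is the section of $S^2$ by the affine plane through $A,B,C$, oriented by the cyclic order of the vertices; of its two antipodal centers on $S^2$, the circumcenter of the oriented triangle $ABC$ is the one chosen by the right-hand rule, i.e. the unit vector positively proportional to $(A-B)\times(A-C)$. *)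

theory Defs
  imports "HOL-Analysis.Analysis"
begin

unbundle cross3_syntax

text \<open>
  A polygon is the list of its vertices, with indices read modulo its length. The condition on
  consecutive vertices includes the pair formed by the last vertex and the first.
\<close>

definition spherical_polygon :: "(real^3) list \<Rightarrow> bool" where
  "spherical_polygon P \<longleftrightarrow>
     P \<noteq> [] \<and> set P \<subseteq> sphere 0 1 \<and>
     (\<forall>i<length P. P ! i \<noteq> P ! (Suc i mod length P))"

text \<open>
  For nonzero \<open>v\<close>, \<open>sgn v\<close> is the unit vector positively proportional to \<open>v\<close>. The lemmas
  \<open>norm_circumcenter\<close> and \<open>circumcenter_equidistant\<close> below confirm that this really is a center
  on the unit sphere of the circle through \<open>A\<close>, \<open>B\<close> and \<open>C\<close>.
\<close>

definition circumcenter :: "real^3 \<Rightarrow> real^3 \<Rightarrow> real^3 \<Rightarrow> real^3" where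
  "circumcenter A B C = sgn ((A - B) \<times> (A - C))"

text \<open>
  Lebesgue measure on \<open>real^3\<close> vanishes on plane triangles. The area is therefore measured on a
  congruent triangle in \<open>real^2\<close>; the lemma \<open>triangle_area_eqI\<close> shows that any congruent copy
  gives the same value, and \<open>congruent_planar_triangle\<close> that one exists.
\<close>

definition triangle_area :: "real^3 \<Rightarrow> real^3 \<Rightarrow> real^3 \<Rightarrow> real" where
  "triangle_area A B C =
     (THE r. \<exists>a b c :: real^2.
        dist a b = dist A B \<and> dist a c = dist A C \<and> dist b c = dist B C \<and>
        r = measure lborel (convex hull {a, b, c}))"

definition mass_vector :: "(real^3) list \<Rightarrow> real^3 \<Rightarrow> real^3" where
  "mass_vector P W =
     (\<Sum>i<length P.
        triangle_area W (P ! i) (P ! (Suc i mod length P)) *\<^sub>R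
        circumcenter W (P ! i) (P ! (Suc i mod length P)))"

text \<open>
  The center of mass is meaningful only if \<open>mass_vector P W \<noteq> 0\<close>.
\<close>

definition ccm :: "(real^3) list \<Rightarrow> real^3 \<Rightarrow> real^3" where
  "ccm P W = mass_vector P W /\<^sub>R norm (mass_vector P W)"

lemma cross_differences_nonzero:
  fixes A B C :: "real^3"
  assumes "A \<in> sphere 0 1" "B \<in> sphere 0 1" "C \<in> sphere 0 1"
    and "A \<noteq> B" "B \<noteq> C" "A \<noteq> C"
  shows "(A - B) \<times> (A - C) \<noteq> 0"
proof
  define u v where "u = B - A" and "v = C - A"
  assume "(A - B) \<times> (A - C) = 0"
  then have "u \<times> v = 0"
    unfolding u_def v_def by (metis cross_minus_left cross_minus_right minus_diff_eq minus_zero)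
  then have "collinear {0, u, v}"
    by (simp add: cross_eq_0)
  moreover have "u \<noteq> 0" "v \<noteq> 0" "u \<noteq> v"
    using assms by (auto simp: u_def v_def)
  ultimately obtain k where k: "v = k *\<^sub>R u"
    by (auto simp: collinear_lemma)
  have AA: "A \<bullet> A = 1" and BB: "(A + u) \<bullet> (A + u) = 1" and CC: "(A + v) \<bullet> (A + v) = 1"
    using assms by (auto simp: u_def v_def dot_square_norm)
  have 1: "2 * (A \<bullet> u) = - (u \<bullet> u)"
    using AA BB by (simp add: inner_add_left inner_add_right inner_commute)
  have "2 * k * (A \<bullet> u) + k * k * (u \<bullet> u) = 0"
    using AA CC by (simp add: k inner_add_left inner_add_right inner_commute)
  moreover have "2 * k * (A \<bullet> u) = - k * (u \<bullet> u)"
    using arg_cong[OF 1, of "\<lambda>t. k * t"] by (simp add: mult.assoc mult.left_commute)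
  ultimately have "k * (k - 1) * (u \<bullet> u) = 0"
    by (simp add: algebra_simps)
  with \<open>u \<noteq> 0\<close> have "k = 0 \<or> k = 1"
    by simp
  with k \<open>v \<noteq> 0\<close> \<open>u \<noteq> v\<close> show False
    by auto
qed

lemma norm_circumcenter:
  assumes "A \<in> sphere 0 1" "B \<in> sphere 0 1" "C \<in> sphere 0 1"
    and "A \<noteq> B" "B \<noteq> C" "A \<noteq> C"
  shows "norm (circumcenter A B C) = 1"
  using cross_differences_nonzero[OF assms] by (simp add: circumcenter_def norm_sgn)

lemma circumcenter_equidistant:
  assumes "A \<in> sphere 0 1" "B \<in> sphere 0 1" "C \<in> sphere 0 1"
  shows "dist (circumcenter A B C) A = dist (circumcenter A B C) B"
    and "dist (circumcenter A B C) A = dist (circumcenter A B C) C"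
proof -
  define Q where "Q = circumcenter A B C"
  have "Q \<bullet> (A - B) = 0" "Q \<bullet> (A - C) = 0"
    by (simp_all add: Q_def circumcenter_def sgn_div_norm inner_commute dot_cross_self)
  then have "Q \<bullet> A = Q \<bullet> B" "Q \<bullet> A = Q \<bullet> C"
    by (simp_all add: inner_diff_right)
  moreover have "A \<bullet> A = 1" "B \<bullet> B = 1" "C \<bullet> C = 1"
    using assms by (auto simp: dot_square_norm)
  ultimately show "dist (circumcenter A B C) A = dist (circumcenter A B C) B"
    and "dist (circumcenter A B C) A = dist (circumcenter A B C) C"
    unfolding Q_def[symmetric]
    by (simp_all add: dist_norm norm_eq_sqrt_inner inner_diff_left inner_diff_right inner_commute)
qed

lemma congruent_planar_triangle:
  fixes A B C :: "real^3"
  obtains a b c :: "real^2"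
  where "dist a b = dist A B" "dist a c = dist A C" "dist b c = dist B C"
proof -
  define u v where "u = B - A" and "v = C - A"
  define p where "p = norm u"
  define q where "q = (u \<bullet> v) / p"
  define h where "h = norm (u \<times> v) / p"
  define c where "c = (if u = 0 then vector [norm v, 0] else vector [q, h] :: real^2)"
  define b where "b = (vector [p, 0] :: real^2)"
  have sq: "q\<^sup>2 + h\<^sup>2 = (norm v)\<^sup>2" if "u \<noteq> 0"
    using that norm_cross_dot[of u v]
    by (simp add: q_def h_def p_def power_divide power_mult_distrib field_simps)
  have pq: "p * q = u \<bullet> v" if "u \<noteq> 0"
    using that by (simp add: q_def p_def)
  have n2: "norm x = sqrt ((x $ 1)\<^sup>2 + (x $ 2)\<^sup>2)" for x :: "real^2"
    by (simp add: norm_vec_def L2_set_def sum_2)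
  have b: "norm b = norm u"
    by (simp add: n2 b_def p_def)
  have c: "norm c = norm v"
    using sq by (auto simp: n2 c_def)
  have "(norm (b - c))\<^sup>2 = (norm (u - v))\<^sup>2"
  proof (cases "u = 0")
    case True
    then show ?thesis by (simp add: n2 b_def c_def p_def)
  next
    case False
    have "(norm (b - c))\<^sup>2 = (p - q)\<^sup>2 + h\<^sup>2"
      using False by (simp add: n2 b_def c_def)
    also have "\<dots> = p\<^sup>2 - 2 * (p * q) + (q\<^sup>2 + h\<^sup>2)"
      by (simp add: power2_eq_square algebra_simps)
    also have "\<dots> = (norm (u - v))\<^sup>2"
      unfolding sq[OF False] pq[OF False] unfolding p_def power2_norm_eq_inner
      by (simp add: inner_diff_left inner_diff_right inner_commute)
    finally show ?thesis .
  qed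
  then have bc: "norm (b - c) = norm (u - v)"
    by simp
  show thesis
  proof (rule that[of 0 b c])
    show "dist 0 b = dist A B"
      using b by (simp add: u_def dist_norm norm_minus_commute)
    show "dist 0 c = dist A C"
      using c by (simp add: v_def dist_norm norm_minus_commute)
    show "dist b c = dist B C"
      using bc by (simp add: u_def v_def dist_norm)
  qed
qed

lemma triangle_area_eqI:
  fixes a b c :: "real^2"
  assumes "dist a b = dist A B" "dist a c = dist A C" "dist b c = dist B C"
  shows "triangle_area A B C = measure lborel (convex hull {a, b, c})"
  unfolding triangle_area_def
proof (rule the_equality)
  show "\<exists>x y z :: real^2. dist x y = dist A B \<and> dist x z = dist A C \<and> dist y z = dist B C \<and>
          measure lborel (convex hull {a, b, c}) = measure lborel (convex hull {x, y, z})"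
    using assms by blast
qed (use assms in \<open>auto simp: heron\<close>)

end

theory Submission
  imports Defs
begin

text \<open>
  The mass of a triangle is half the norm of the cross product of two sides, so
  \<open>m\<^sub>i O\<^sub>i = \<onehalf> (W - V\<^sub>i) \<times> (W - V\<^sub>i\<^sub>+\<^sub>1)\<close>. Expanding the product, the terms containing \<open>W\<close>
  telescope around the polygon and \<open>\<onehalf> \<Sum> V\<^sub>i \<times> V\<^sub>i\<^sub>+\<^sub>1\<close> remains.
\<close>

text \<open>Heron's formula gives the area from the side lengths, and Lagrange's identity turns it
  into the norm of a cross product. Degenerate triangles are covered.\<close>

lemma triangle_area_cross:
  "triangle_area A B C = norm ((A - B) \<times> (A - C)) / 2"
proof -
  obtain a b c :: "real^2"
    where d: "dist a b = dist A B" "dist a c = dist A C" "dist b c = dist B C"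
    by (rule congruent_planar_triangle)
  define p q where "p = A - B" and "q = A - C"
  define x y z where "x = dist B C" and "y = dist A C" and "z = dist A B"
  have xyz: "x\<^sup>2 = p \<bullet> p - 2 * (p \<bullet> q) + q \<bullet> q" "y\<^sup>2 = q \<bullet> q" "z\<^sup>2 = p \<bullet> p"
    unfolding x_def y_def z_def p_def q_def dist_norm power2_norm_eq_inner
    by (simp_all add: inner_diff_left inner_diff_right inner_commute)
  define s where "s = (x + y + z) / 2"
  have cross: "(norm (p \<times> q))\<^sup>2 = (p \<bullet> p) * (q \<bullet> q) - (p \<bullet> q)\<^sup>2"
    by (simp only: norm_cross) (simp add: power2_norm_eq_inner)
  \<comment> \<open>By the law of cosines the squared bracket is \<open>2 * (p \<bullet> q)\<close>,
    so the left side is also four times the Gram determinant of \<open>p\<close> and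
    \<open>q\<close>.\<close>
  have "4 * z\<^sup>2 * y\<^sup>2 - (z\<^sup>2 + y\<^sup>2 - x\<^sup>2)\<^sup>2 = 16 * (s * (s - x) * (s - y) * (s - z))"
    unfolding s_def by (simp add: field_simps power2_eq_square)
  moreover have "4 * z\<^sup>2 * y\<^sup>2 - (z\<^sup>2 + y\<^sup>2 - x\<^sup>2)\<^sup>2 = 4 * (norm (p \<times> q))\<^sup>2"
    unfolding xyz cross by (simp add: algebra_simps power2_eq_square)
  ultimately have "s * (s - x) * (s - y) * (s - z) = (norm (p \<times> q) / 2)\<^sup>2"
    by (simp add: power_divide)
  moreover have "measure lborel (convex hull {a, b, c}) = sqrt (s * (s - x) * (s - y) * (s - z))"
    unfolding heron d x_def y_def z_def s_def ..
  ultimately have "measure lborel (convex hull {a, b, c}) = norm (p \<times> q) / 2"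
    by simp
  then show ?thesis
    by (simp add: triangle_area_eqI[OF d] p_def q_def)
qed

text \<open>The norm in the area cancels the normalization in \<open>sgn\<close>; if the cross
  product vanishes, both sides are 0.\<close>

lemma triangle_area_circumcenter:
  "triangle_area A B C *\<^sub>R circumcenter A B C = (1/2) *\<^sub>R ((A - B) \<times> (A - C))"
  by (cases "(A - B) \<times> (A - C) = 0") (simp_all add: triangle_area_cross circumcenter_def sgn_div_norm)

lemma sum_cyclic_shift:
  fixes f :: "nat \<Rightarrow> 'a::comm_monoid_add"
  shows "(\<Sum>i<n. f (Suc i mod n)) = (\<Sum>i<n. f i)"
proof (cases n)
  case (Suc m)
  \<comment> \<open>Only the last index \<open>i = m\<close> wraps around.\<close>
  have "(\<Sum>i<n. f (Suc i mod n)) = (\<Sum>i<m. f (Suc i)) + f 0"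
    by (simp add: Suc)
  also have "\<dots> = (\<Sum>i<n. f i)"
    by (simp add: Suc sum.lessThan_Suc_shift add.commute del: sum.lessThan_Suc)
  finally show ?thesis .
qed simp

lemma mass_vector_eq:
  "mass_vector P W = (1/2) *\<^sub>R (\<Sum>i<length P. P ! i \<times> P ! (Suc i mod length P))"
proof -
  define V V' where "V i = P ! i" and "V' i = P ! (Suc i mod length P)" for i
  \<comment> \<open>\<open>W \<times> W\<close> vanishes, and antisymmetry moves \<open>W\<close> to
    the left in both mixed terms, so that their sums differ by a cyclic shift.\<close>
  have "(W - V i) \<times> (W - V' i) = V i \<times> V' i + (W \<times> V i - W \<times> V' i)" for i
    by (simp add: cross3_simps)
  then have "mass_vector P W = (1/2) *\<^sub>R
      ((\<Sum>i<length P. V i \<times> V' i) + ((\<Sum>i<length P. W \<times> V i) - (\<Sum>i<length P. W \<times> V' i)))"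
    by (simp add: mass_vector_def triangle_area_circumcenter V_def V'_def
        sum.distrib sum_subtractf flip: scaleR_sum_right)
  then show ?thesis
    using sum_cyclic_shift[of "\<lambda>i. W \<times> P ! i" "length P"] by (simp add: V_def V'_def)
qed

theorem theorem8:
  fixes P :: "(real^3) list" and W W' :: "real^3"
  assumes "spherical_polygon P"
    and "W \<in> sphere 0 1" "W \<notin> set P"
    and "W' \<in> sphere 0 1" "W' \<notin> set P"
    and "mass_vector P W \<noteq> 0"
  shows "mass_vector P W' \<noteq> 0 \<and> ccm P W' = ccm P W"
  \<comment> \<open>The right side of \<open>mass_vector_eq\<close> is free of \<open>W\<close>, so
    nonvanishing carries over to \<open>W'\<close> as well.\<close>
  using assms(6) by (simp add: ccm_def mass_vector_eq)

end
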